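(* Let $I\subset\mathbb R$ be an interval, let $\mathbf r:I\to\mathbb H_1$ be a smooth horizontally regular curve parametrized by horizontal arc length, with $p$-curvature $\kappa$ and contact normality $\tau$. Fix $s_0\in I$ and define $$\theta(s)=\int_{s_0}^s\kappa(t)\,dt,\qquad A(s)=\int_{s_0}^s\cos\theta(t)\,dt,\qquad B(s)=\int_{s_0}^s\sin\theta(t)\,dt .$$ Then the set of all solutions $(u_1,u_2,u_3)$ on $I$ of the system $$u_1'=\kappa u_2-1,\qquad u_2'=-\kappa u_1,\qquad u_3'=u_2-\tau$$ is given by $$\begin{aligned}u_1(s)&=(c_1-A(s))\cos\theta(s)+(c_2-B(s))\sin\theta(s),\\ u_2(s)&=-(c_1-A(s))\sin\theta(s)+(c_2-B(s))\cos\theta(s),\\ u_3(s)&=c_3+\int_{s_0}^s\bigl(u_2(t)-\tau(t)\bigr)\,dt,\end{aligned}$$ where $c_1,c_2,c_3$ are arbitrary real constants. (No assumption that $\kappa$ is nonvanishing is made.)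
   Context: The Heisenberg group $\mathbb H_1$ is identified with $\mathbb R^3$ through its standard coordinates $(x,y,z)$. A smooth curve $\mathbf r=(x,y,z)$ is horizontally regular if $(x')^2+(y')^2\neq0$ everywhere, and parametrized by horizontal arc length if $(x')^2+(y')^2\equiv1$. For such a parametrization the $p$-curvature is $\kappa=x'y''-x''y'$ and the contact normality is $\tau=xy'-x'y+z'$; both are smooth functions on $I$. *)

theory Defs
  imports "HOL-Analysis.Analysis"
begin

text \<open>The Heisenberg group, identified with Euclidean 3-space via its standard coordinates
  \<open>x\<close> = component 1, \<open>y\<close> = component 2, \<open>z\<close> = component 3.\<close>

type_synonym heisenberg = "real ^ 3"

text \<open>Derivatives are relative to the interval \<open>I\<close>, hence one-sided at an endpoint belonging to \<open>I\<close>;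
  only the values on \<open>I\<close> matter.\<close>

definition deriv_on :: "real set \<Rightarrow> (real \<Rightarrow> 'a::real_normed_vector) \<Rightarrow> real \<Rightarrow> 'a" where
  "deriv_on I f s = vector_derivative f (at s within I)"

definition smooth_on :: "real set \<Rightarrow> (real \<Rightarrow> 'a::real_normed_vector) \<Rightarrow> bool" where
  "smooth_on I f \<longleftrightarrow> (\<forall>n. (deriv_on I ^^ n) f differentiable_on I)"

abbreviation x_coord :: "(real \<Rightarrow> heisenberg) \<Rightarrow> real \<Rightarrow> real" where
  "x_coord r \<equiv> \<lambda>s. r s $ 1"

abbreviation y_coord :: "(real \<Rightarrow> heisenberg) \<Rightarrow> real \<Rightarrow> real" where
  "y_coord r \<equiv> \<lambda>s. r s $ 2"

abbreviation z_coord :: "(real \<Rightarrow> heisenberg) \<Rightarrow> real \<Rightarrow> real" where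
  "z_coord r \<equiv> \<lambda>s. r s $ 3"

definition horizontally_regular :: "real set \<Rightarrow> (real \<Rightarrow> heisenberg) \<Rightarrow> bool" where
  "horizontally_regular I r \<longleftrightarrow>
     (\<forall>s\<in>I. (deriv_on I (x_coord r) s)\<^sup>2 + (deriv_on I (y_coord r) s)\<^sup>2 \<noteq> 0)"

definition horizontal_arc_length_param :: "real set \<Rightarrow> (real \<Rightarrow> heisenberg) \<Rightarrow> bool" where
  "horizontal_arc_length_param I r \<longleftrightarrow>
     (\<forall>s\<in>I. (deriv_on I (x_coord r) s)\<^sup>2 + (deriv_on I (y_coord r) s)\<^sup>2 = 1)"

definition p_curvature :: "real set \<Rightarrow> (real \<Rightarrow> heisenberg) \<Rightarrow> real \<Rightarrow> real" where
  "p_curvature I r s =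
     deriv_on I (x_coord r) s * deriv_on I (deriv_on I (y_coord r)) s
     - deriv_on I (deriv_on I (x_coord r)) s * deriv_on I (y_coord r) s"

definition contact_normality :: "real set \<Rightarrow> (real \<Rightarrow> heisenberg) \<Rightarrow> real \<Rightarrow> real" where
  "contact_normality I r s =
     x_coord r s * deriv_on I (y_coord r) s - deriv_on I (x_coord r) s * y_coord r s
     + deriv_on I (z_coord r) s"

definition solves_system ::
  "real set \<Rightarrow> (real \<Rightarrow> real) \<Rightarrow> (real \<Rightarrow> real) \<Rightarrow>
   (real \<Rightarrow> real) \<Rightarrow> (real \<Rightarrow> real) \<Rightarrow> (real \<Rightarrow> real) \<Rightarrow> bool" where
  "solves_system I \<kappa> \<tau> u1 u2 u3 \<longleftrightarrow>
     (\<forall>s\<in>I. (u1 has_real_derivative \<kappa> s * u2 s - 1) (at s within I) \<and>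
            (u2 has_real_derivative - \<kappa> s * u1 s) (at s within I) \<and>
            (u3 has_real_derivative u2 s - \<tau> s) (at s within I))"

end

theory Submission
  imports Defs
begin

text \<open>In the frame rotating by \<open>\<theta>\<close> the first two equations decouple and become integrable:
  along a solution, \<open>u1 cos \<theta> - u2 sin \<theta> + A\<close> and \<open>u1 sin \<theta> + u2 cos \<theta> + B\<close> have zero derivative,
  so they are the constants \<open>c1\<close> and \<open>c2\<close>; inverting the rotation gives the formulas.\<close>

text \<open>A nondegenerate interval is connected and not a singleton, so each of its points is a
  limit point. This makes derivatives relative to \<open>I\<close> unique, including at
  endpoints.\<close>

lemma interval_at_within_ne_bot:
  fixes I :: "real set"
  assumes "is_interval I" "interior I \<noteq> {}" "s \<in> I"
  shows "at s within I \<noteq> bot"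
proof -
  have "connected I"
    using assms(1) by (simp add: is_interval_connected)
  moreover have "I \<noteq> {s}"
    using assms(2) by auto
  ultimately have "s islimpt I"
    using assms(3) connected_imp_perfect by blast
  then show ?thesis
    by (simp add: trivial_limit_within)
qed

lemma vec_nth_has_vector_derivative:
  assumes "(f has_vector_derivative D) F"
  shows "((\<lambda>s. f s $ i) has_vector_derivative D $ i) F"
  using bounded_linear.has_vector_derivative[OF bounded_linear_vec_nth assms] .

text \<open>At a point of \<open>I\<close> the derivative within \<open>I\<close> sees only values
  on \<open>I\<close>. Both sides therefore choose from the same predicate, even where no derivative
  exists.\<close>

lemma deriv_on_cong:
  assumes "\<And>t. t \<in> I \<Longrightarrow> f t = g t" "s \<in> I"
  shows "deriv_on I f s = deriv_on I g s"
proof -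
  have "(f has_vector_derivative D) (at s within I) \<longleftrightarrow> (g has_vector_derivative D) (at s within I)" for D
    using assms by (intro iffI; elim has_vector_derivative_transform[rotated 2]; simp)
  then show ?thesis
    by (simp add: deriv_on_def vector_derivative_def)
qed

lemma deriv_on_vec_nth:
  fixes f :: "real \<Rightarrow> real ^ 'n"
  assumes "at s within I \<noteq> bot" "f differentiable (at s within I)"
  shows "deriv_on I (\<lambda>t. f t $ i) s = deriv_on I f s $ i"
  unfolding deriv_on_def
  using assms vec_nth_has_vector_derivative vector_derivative_within vector_derivative_works by blast

text \<open>Projection is bounded linear, so it commutes with every iterated derivative. The
  commutation holds only on \<open>I\<close>, so it is carried under the next derivative by
  \<open>deriv_on_cong\<close>.\<close>

lemma smooth_on_vec_nth:
  fixes f :: "real \<Rightarrow> real ^ 'n"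
  assumes "is_interval I" "interior I \<noteq> {}" "smooth_on I f"
  shows "smooth_on I (\<lambda>t. f t $ i)"
proof -
  have eq: "(deriv_on I ^^ n) (\<lambda>t. f t $ i) s = (deriv_on I ^^ n) f s $ i" if "s \<in> I" for n s
    using that
  proof (induction n arbitrary: s)
    case (Suc n)
    have "(deriv_on I ^^ n) f differentiable (at s within I)"
      using assms(3) Suc.prems by (simp add: smooth_on_def differentiable_on_def)
    then have "deriv_on I (\<lambda>t. (deriv_on I ^^ n) f t $ i) s = (deriv_on I ^^ Suc n) f s $ i"
      using interval_at_within_ne_bot[OF assms(1,2) Suc.prems] by (simp add: deriv_on_vec_nth)
    then show ?case
      using deriv_on_cong[OF Suc.IH Suc.prems] by simp
  qed simp
  have "(deriv_on I ^^ n) (\<lambda>t. f t $ i) differentiable (at s within I)" if "s \<in> I" for n s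
  proof -
    have "(deriv_on I ^^ n) f differentiable (at s within I)"
      using assms(3) that by (simp add: smooth_on_def differentiable_on_def)
    then have "(\<lambda>t. (deriv_on I ^^ n) f t $ i) differentiable (at s within I)"
      unfolding vector_derivative_works
      by (rule differentiableI_vector[OF vec_nth_has_vector_derivative, unfolded vector_derivative_works])
    then show ?thesis
      by (rule differentiable_transform_within[OF _ zero_less_one that]) (simp add: eq)
  qed
  then show ?thesis
    by (simp add: smooth_on_def differentiable_on_def)
qed

lemma smooth_on_imp_continuous_on: "smooth_on I f \<Longrightarrow> continuous_on I f"
  unfolding smooth_on_def
  by (drule spec[where x = 0]) (simp add: differentiable_imp_continuous_on)

lemma smooth_on_deriv_on: "smooth_on I f \<Longrightarrow> smooth_on I (deriv_on I f)"
  unfolding smooth_on_def 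
proof
  fix n
  assume "\<forall>n. (deriv_on I ^^ n) f differentiable_on I"
  then have "(deriv_on I ^^ Suc n) f differentiable_on I"
    by blast
  then show "(deriv_on I ^^ n) (deriv_on I f) differentiable_on I"
    by (simp only: funpow_Suc_right o_apply)
qed

text \<open>Both functions are polynomials in the coordinates and their first two derivatives.
  Continuity is what lets the integrals in the solution formulas be differentiated.\<close>

lemma
  assumes "is_interval I" "interior I \<noteq> {}" "smooth_on I r"
  shows continuous_on_p_curvature: "continuous_on I (p_curvature I r)"
    and continuous_on_contact_normality: "continuous_on I (contact_normality I r)"
proof -
  note [continuous_intros] = smooth_on_imp_continuous_on
  note [simp] = smooth_on_vec_nth[OF assms] smooth_on_deriv_on
  show "continuous_on I (p_curvature I r)"
    unfolding p_curvature_def by (intro continuous_intros) simp_all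
  show "continuous_on I (contact_normality I r)"
    unfolding contact_normality_def by (intro continuous_intros) simp_all
qed

text \<open>\<open>I\<close> may be open, half-open or unbounded, whereas the fundamental theorem is
  applied on a compact \<open>{a..b}\<close>. It suffices that \<open>{a..b}\<close> lies in
  \<open>I\<close>, contains \<open>s0\<close> and \<open>s\<close>, and coincides with
  \<open>I\<close> near \<open>s\<close>; the oriented integral covers
  \<open>s < s0\<close>.\<close>

lemma interval_integral_has_derivative_within:
  fixes f :: "real \<Rightarrow> real"
  assumes I: "is_interval I" "s0 \<in> I" "s \<in> I" and f: "continuous_on I f"
  shows "((\<lambda>u. LBINT t=s0..u. f t) has_real_derivative f s) (at s within I)"
proof -
  \<comment> \<open>Either \<open>a\<close> leaves room to the left of \<open>s\<close>, or
    \<open>I\<close> has nothing to the left of \<open>a\<close>; \<open>b\<close> is chosen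
    symmetrically.\<close>
  obtain a where a: "a \<in> I" "a \<le> s0" "a \<le> s" "a < s \<or> (\<forall>x\<in>I. a \<le> x)"
  proof (cases "\<exists>y\<in>I. y < min s s0")
    case True
    then obtain y where "y \<in> I" "y < s" "y < s0"
      by auto
    then show ?thesis
      using that[of y] by simp
  next
    case False
    have "min s s0 \<in> I"
      using I(2,3) by (simp add: min_def)
    moreover have "\<forall>x\<in>I. min s s0 \<le> x"
      using False by (meson not_less)
    ultimately show ?thesis
      by (intro that[of "min s s0"]) auto
  qed
  obtain b where b: "b \<in> I" "s0 \<le> b" "s \<le> b" "s < b \<or> (\<forall>x\<in>I. x \<le> b)"
  proof (cases "\<exists>y\<in>I. max s s0 < y")
    case True
    then obtain y where "y \<in> I" "s < y" "s0 < y"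
      by auto
    then show ?thesis
      using that[of y] by simp
  next
    case False
    have "max s s0 \<in> I"
      using I(2,3) by (simp add: max_def)
    moreover have "\<forall>x\<in>I. x \<le> max s s0"
      using False by (meson not_less)
    ultimately show ?thesis
      by (intro that[of "max s s0"]) auto
  qed
  have sub: "{a..b} \<subseteq> I"
    using mem_is_interval_1_I[OF I(1) a(1) b(1)] by auto
  \<comment> \<open>An open window around \<open>s\<close>. If \<open>a < s\<close> fails, then
    \<open>a = s\<close> is the least point of \<open>I\<close>, so widening the window by 1 on that
    side captures no further point of \<open>I\<close>; likewise on the right.\<close>
  define S where "S = {(if a < s then a else s - 1)<..<(if s < b then b else s + 1)}"
  have eq: "I \<inter> S - {s} = {a..b} \<inter> S - {s}"
  proof -
    have "a \<le> x" "x \<le> b" if "x \<in> I" "x \<in> S" for x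
      using that a(4) b(4) by (auto simp: S_def split: if_splits)
    then show ?thesis
      using sub by auto
  qed
  have "s \<in> S" "open S"
    using a(3) b(3) by (simp_all add: S_def)
  then have "at s within I = at s within {a..b}"
    using eq by (rule at_within_nhd)
  moreover have "((\<lambda>u. LBINT t=s0..u. f t) has_vector_derivative f s) (at s within {a..b})"
    using a(3) b(3) by (rule interval_integral_FTC2[OF a(2) b(2) continuous_on_subset[OF f sub]])
  ultimately show ?thesis
    by (simp add: has_real_derivative_iff_has_vector_derivative)
qed

text \<open>The inverse of a rotation is its transpose. This recovers \<open>u1\<close> and
  \<open>u2\<close> from their components in the rotating frame.\<close>

lemma rotation_inverse:
  fixes x y p q t :: real
  assumes "p = x * cos t - y * sin t" "q = x * sin t + y * cos t"
  shows "x = p * cos t + q * sin t" "y = - p * sin t + q * cos t"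
proof -
  \<comment> \<open>The Pythagorean identity under a factor \<open>z\<close>, a shape that rewrites
    the expanded products.\<close>
  have "z * (cos t * cos t) = z - z * (sin t * sin t)" for z :: real
  proof -
    have "cos t * cos t = 1 - sin t * sin t"
      using sin_cos_squared_add3[of t] by linarith
    then show ?thesis
      by (simp add: right_diff_distrib)
  qed
  then show "x = p * cos t + q * sin t" "y = - p * sin t + q * cos t"
    unfolding assms by (simp_all add: algebra_simps)
qed

lemma zero_derivative_constant_on_interval:
  fixes f :: "real \<Rightarrow> real"
  assumes "is_interval I" "\<And>s. s \<in> I \<Longrightarrow> (f has_real_derivative 0) (at s within I)"
  obtains c where "\<And>s. s \<in> I \<Longrightarrow> f s = c"
  using has_field_derivative_zero_constant[of I f] assms is_interval_convex by blast

theorem mainTheorem2: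
  fixes I :: "real set" and r :: "real \<Rightarrow> heisenberg" and s0 :: real
    and \<kappa> \<tau> \<theta> A B :: "real \<Rightarrow> real"
  assumes "is_interval I" and "interior I \<noteq> {}"
    and "smooth_on I r"
    and "horizontally_regular I r"
    and "horizontal_arc_length_param I r"
    and "\<kappa> = p_curvature I r" and "\<tau> = contact_normality I r"
    and "s0 \<in> I"
    and "\<theta> = (\<lambda>s. LBINT t=s0..s. \<kappa> t)"
    and "A = (\<lambda>s. LBINT t=s0..s. cos (\<theta> t))"
    and "B = (\<lambda>s. LBINT t=s0..s. sin (\<theta> t))"
  shows "\<forall>u1 u2 u3. solves_system I \<kappa> \<tau> u1 u2 u3 \<longleftrightarrow>
    (\<exists>c1 c2 c3. \<forall>s\<in>I.
       u1 s = (c1 - A s) * cos (\<theta> s) + (c2 - B s) * sin (\<theta> s) \<and>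
       u2 s = - (c1 - A s) * sin (\<theta> s) + (c2 - B s) * cos (\<theta> s) \<and>
       u3 s = c3 + (LBINT t=s0..s. u2 t - \<tau> t))"
proof (intro allI)
  fix u1 u2 u3 :: "real \<Rightarrow> real"
  have \<kappa>: "continuous_on I \<kappa>" and \<tau>: "continuous_on I \<tau>"
    using assms(1-3,6,7) continuous_on_p_curvature continuous_on_contact_normality by auto
  note FTC = interval_integral_has_derivative_within[OF \<open>is_interval I\<close> \<open>s0 \<in> I\<close>]
  have d\<theta>: "(\<theta> has_real_derivative \<kappa> s) (at s within I)" if "s \<in> I" for s
    using FTC[OF that \<kappa>] assms(9) by simp
  then have \<theta>: "continuous_on I \<theta>"
    by (meson DERIV_continuous continuous_on_eq_continuous_within)
  have dA: "(A has_real_derivative cos (\<theta> s)) (at s within I)" if "s \<in> I" for s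
    using FTC[OF that continuous_on_cos[OF \<theta>]] assms(10) by simp
  have dB: "(B has_real_derivative sin (\<theta> s)) (at s within I)" if "s \<in> I" for s
    using FTC[OF that continuous_on_sin[OF \<theta>]] assms(11) by simp
  note [derivative_intros] = d\<theta> dA dB
  \<comment> \<open>Needed in both directions. The derivative \<open>D\<close> of \<open>u2\<close>
    serves only to make the integrand continuous.\<close>
  have d3: "((\<lambda>s. LBINT t=s0..s. u2 t - \<tau> t) has_real_derivative u2 s - \<tau> s) (at s within I)"
    if "\<And>s. s \<in> I \<Longrightarrow> (u2 has_real_derivative D s) (at s within I)" "s \<in> I" for D s
  proof (rule FTC[OF that(2)])
    have "continuous_on I u2"
      using that(1) by (meson DERIV_continuous continuous_on_eq_continuous_within)
    then show "continuous_on I (\<lambda>t. u2 t - \<tau> t)"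
      by (intro continuous_intros \<tau>)
  qed
  let ?form = "\<lambda>c1 c2 c3 s.
       u1 s = (c1 - A s) * cos (\<theta> s) + (c2 - B s) * sin (\<theta> s) \<and>
       u2 s = - (c1 - A s) * sin (\<theta> s) + (c2 - B s) * cos (\<theta> s) \<and>
       u3 s = c3 + (LBINT t=s0..s. u2 t - \<tau> t)"
  show "solves_system I \<kappa> \<tau> u1 u2 u3 \<longleftrightarrow> (\<exists>c1 c2 c3. \<forall>s\<in>I. ?form c1 c2 c3 s)"
  proof
    assume "solves_system I \<kappa> \<tau> u1 u2 u3"
    then have du: "(u1 has_real_derivative \<kappa> s * u2 s - 1) (at s within I)"
      "(u2 has_real_derivative - \<kappa> s * u1 s) (at s within I)"
      "(u3 has_real_derivative u2 s - \<tau> s) (at s within I)" if "s \<in> I" for s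
      using that by (auto simp: solves_system_def)
    note [derivative_intros] = du
    \<comment> \<open>The terms with \<kappa> cancel because \<theta>' = \<kappa>, and A' = cos
      \<theta> compensates the forcing term -1 of the first equation. In the second combination
      below, B' = sin \<theta> does the same.\<close>
    have "((\<lambda>s. u1 s * cos (\<theta> s) - u2 s * sin (\<theta> s) + A s) has_real_derivative 0) (at s within I)"
      if "s \<in> I" for s
      by (rule derivative_eq_intros refl that)+ (simp add: algebra_simps)
    then obtain c1 where c1: "\<And>s. s \<in> I \<Longrightarrow> u1 s * cos (\<theta> s) - u2 s * sin (\<theta> s) + A s = c1"
      using zero_derivative_constant_on_interval[OF \<open>is_interval I\<close>] by blast
    have "((\<lambda>s. u1 s * sin (\<theta> s) + u2 s * cos (\<theta> s) + B s) has_real_derivative 0) (at s within I)"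
      if "s \<in> I" for s
      by (rule derivative_eq_intros refl that)+ (simp add: algebra_simps)
    then obtain c2 where c2: "\<And>s. s \<in> I \<Longrightarrow> u1 s * sin (\<theta> s) + u2 s * cos (\<theta> s) + B s = c2"
      using zero_derivative_constant_on_interval[OF \<open>is_interval I\<close>] by blast
    have "((\<lambda>s. u3 s - (LBINT t=s0..s. u2 t - \<tau> t)) has_real_derivative 0) (at s within I)"
      if "s \<in> I" for s
      using DERIV_diff[OF du(3)[OF that] d3[OF du(2) that]] by simp
    then obtain c3 where c3: "\<And>s. s \<in> I \<Longrightarrow> u3 s - (LBINT t=s0..s. u2 t - \<tau> t) = c3"
      using zero_derivative_constant_on_interval[OF \<open>is_interval I\<close>] by blast
    have "?form c1 c2 c3 s" if "s \<in> I" for s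
    proof -
      \<comment> \<open>The pair \<open>(c1 - A s, c2 - B s)\<close> is \<open>(u1 s, u2 s)\<close>
        rotated by \<open>\<theta> s\<close>, which is the hypothesis of
        \<open>rotation_inverse\<close>.\<close>
      have "c1 - A s = u1 s * cos (\<theta> s) - u2 s * sin (\<theta> s)"
        "c2 - B s = u1 s * sin (\<theta> s) + u2 s * cos (\<theta> s)"
        "u3 s = c3 + (LBINT t=s0..s. u2 t - \<tau> t)"
        using c1[OF that] c2[OF that] c3[OF that] by simp_all
      then show ?thesis
        using rotation_inverse by blast
    qed
    then show "\<exists>c1 c2 c3. \<forall>s\<in>I. ?form c1 c2 c3 s"
      by blast
  next
    assume "\<exists>c1 c2 c3. \<forall>s\<in>I. ?form c1 c2 c3 s"
    then obtain c1 c2 c3 where form: "\<And>s. s \<in> I \<Longrightarrow> ?form c1 c2 c3 s"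
      by blast
    \<comment> \<open>The formulas describe the functions on \<open>I\<close> alone, so each formula
      is differentiated and the result transferred within \<open>I\<close>. Since agreement holds on
      all of \<open>I\<close>, any radius works, here 1.\<close>
    have du1: "(u1 has_real_derivative \<kappa> s * u2 s - 1) (at s within I)" if "s \<in> I" for s
    proof (rule has_field_derivative_transform_within[OF _ zero_less_one that])
      \<comment> \<open>Differentiating \<open>A\<close> and \<open>B\<close> leaves -cos^2 - sin^2,
        which has to collapse to the -1 of the first equation.\<close>
      have [simp]: "cos (\<theta> s) * cos (\<theta> s) = 1 - sin (\<theta> s) * sin (\<theta> s)"
        using sin_cos_squared_add3[of "\<theta> s"] by linarith
      have u2: "u2 s = - (c1 - A s) * sin (\<theta> s) + (c2 - B s) * cos (\<theta> s)"
        using form that by blast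
      show "((\<lambda>s. (c1 - A s) * cos (\<theta> s) + (c2 - B s) * sin (\<theta> s))
              has_real_derivative \<kappa> s * u2 s - 1) (at s within I)"
        by (rule derivative_eq_intros refl that)+ (simp add: u2 algebra_simps)
    qed (use form in simp)
    have du2: "(u2 has_real_derivative - \<kappa> s * u1 s) (at s within I)" if "s \<in> I" for s
    proof (rule has_field_derivative_transform_within[OF _ zero_less_one that])
      have u1: "u1 s = (c1 - A s) * cos (\<theta> s) + (c2 - B s) * sin (\<theta> s)"
        using form that by blast
      \<comment> \<open>Here A' and B' contribute cos \<theta> sin \<theta> and - sin \<theta> cos
        \<theta>, which cancel, so the second equation has no forcing term.\<close>
      show "((\<lambda>s. - (c1 - A s) * sin (\<theta> s) + (c2 - B s) * cos (\<theta> s))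
              has_real_derivative - \<kappa> s * u1 s) (at s within I)"
        by (rule derivative_eq_intros refl that)+ (simp add: u1 algebra_simps)
    qed (use form in simp)
    have "(u3 has_real_derivative u2 s - \<tau> s) (at s within I)" if "s \<in> I" for s
    proof (rule has_field_derivative_transform_within[OF _ zero_less_one that])
      show "((\<lambda>s. c3 + (LBINT t=s0..s. u2 t - \<tau> t)) has_real_derivative u2 s - \<tau> s) (at s within I)"
        using DERIV_add[OF DERIV_const d3[OF du2 that]] by simp
    qed (use form in simp)
    then show "solves_system I \<kappa> \<tau> u1 u2 u3"
      using du1 du2 by (simp add: solves_system_def)
  qed
qed

end
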